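(* Let $\kappa\leq\lambda$ be infinite cardinals with $\kappa$ regular, and assume $\lambda^{<\kappa}>\lambda$. Then there is a continuous weak $\lambda^+$-measure space $({}^{\kappa}\lambda,\mathfrak{M},\mu)$ on ${}^{\kappa}\lambda$ (with $\mu$ taking values in some positively totally ordered monoid $\mathbb{S}$ with an infinitary sum $\mathsf{Sum}$).
   Context: **Topology.** ${}^{\kappa}\lambda$ is the set of sequences of elements of $\lambda$ of length $\kappa$, with the bounded topology, generated by the cones $\mathbf{N}_s=\{x\in{}^{\kappa}\lambda\mid s\subseteq x\}$ for $s\in{}^{<\kappa}\lambda=\bigcup_{\alpha<\kappa}{}^{\alpha}\lambda$. **Monoids and sums.** A positively totally ordered monoid is $\mathbb{S}=(S,0,+,\leq)$ where $+$ is associative (not necessarily commutative) with neutral element $0$, $\leq$ is a total order, $a\leq b$ and $c\leq d$ imply $a+c\leq b+d$, $0$ is the minimum of $\leq$, and $S\neq\{0\}$. ${}^{<\mathrm{On}}\mathbb{S}$ is the class of all sequences of elements of $S$ of ordinal length; $\mathrm{lh}(s)$ is the length of $s$. An infinitary sum on $\mathbb{S}$ is a partial function $\mathsf{Sum}:{}^{<\mathrm{On}}\mathbb{S}\to\mathbb{S}$ such that: (S1) $\mathsf{Sum}(\emptyset)=0$ and $\mathsf{Sum}(s)=s_0+\dots+s_n$ for every non-empty finite $s=(s_i)_{i\leq n}\in\mathrm{dom}(\mathsf{Sum})$; (S2) (continuity) for all $s\in\mathrm{dom}(\mathsf{Sum})$ of limit length, if $s\restriction\alpha\in\mathrm{dom}(\mathsf{Sum})$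 for cofinally many $\alpha<\mathrm{lh}(s)$, then $\mathsf{Sum}(s)=\sup\{\mathsf{Sum}(s\restriction\alpha)\mid\alpha<\mathrm{lh}(s),\ s\restriction\alpha\in\mathrm{dom}(\mathsf{Sum})\}$. **Measures.** A weakly $\lambda^+$-measurable space is a pair $(X,\mathfrak{M})$ where $X$ is a topological space and $\mathfrak{M}$ is a family of subsets of $X$ closed under unions of size $\leq\lambda$ and containing all open subsets of $X$. A $\lambda^+$-measure on it (with values in $(\mathbb{S},\mathsf{Sum})$) is a partial function $\mu:\mathscr{P}(X)\to\mathbb{S}$ with $\mathfrak{M}\subseteq\mathrm{dom}(\mu)$ such that: (M1) $\mu(\emptyset)=0$; (M2) $\mu(X)>0$; (M3) $A\subseteq B$ implies $\mu(A)\leq\mu(B)$ for all $A,B\in\mathfrak{M}$; (M4) for every family $(A_i)_{i<\gamma}$ of pairwise disjoint sets of $\mathfrak{M}$ of length an ordinal $\gamma<\lambda^+$, we have $\langle\mu(A_i)\mid i<\gamma\rangle\in\mathrm{dom}(\mathsf{Sum})$ and $\mu(\bigcup_{i<\gamma}A_i)=\mathsf{Sum}(\langle\mu(A_i)\mid i<\gamma\rangle)$; (M5) for every $x\in X$ with $\{x\}\in\mathfrak{M}$ and every open local basis $\{A_i\mid i<\gamma\}$ at $x$ with $\gamma<\lambda^+$, $\mu(\{x\})=\inf_{i<\gamma}\mu(A_i)$. Then $(X,\mathfrak{M},\mu)$ is called a weak $\lambda^+$-measure space. It is continuous if $\{x\}\in\mathfrak{M}$ and $\mu(\{x\})=0$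 for every $x\in X$. *)

theory Defs
  imports "HOL-Algebra.Group" "HOL-Analysis.Function_Topology"
begin

unbundle cardinal_syntax

text \<open>
  Ordinals are the elements of the field of a well-order \<open>r\<close>: as usual, \<open>\<alpha>\<close> is identified
  with the set \<open>underS r \<alpha>\<close> of its strict predecessors. A sequence indexed by \<open>I\<close> with values
  in \<open>A\<close> is a partial map with domain \<open>I\<close>, so that end-extension of sequences is the relation
  \<open>\<subseteq>\<^sub>m\<close>, restriction is \<open>|`\<close>, and sequences of different length are different objects.
\<close>

definition seqs :: "'i set \<Rightarrow> 'a set \<Rightarrow> ('i \<rightharpoonup> 'a) set" where
  "seqs I A = {s. dom s = I \<and> ran s \<subseteq> A}"

definition seqs_below :: "'i rel \<Rightarrow> 'a set \<Rightarrow> ('i \<rightharpoonup> 'a) set" where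
  "seqs_below r A = (\<Union>\<alpha>\<in>Field r. seqs (underS r \<alpha>) A)"


definition cone :: "'k rel \<Rightarrow> 'l set \<Rightarrow> ('k \<rightharpoonup> 'l) \<Rightarrow> ('k \<rightharpoonup> 'l) set" where
  "cone kap L s = {x \<in> seqs (Field kap) L. s \<subseteq>\<^sub>m x}"

definition bounded_topology :: "'k rel \<Rightarrow> 'l set \<Rightarrow> ('k \<rightharpoonup> 'l) topology" where
  "bounded_topology kap L = topology_generated_by (cone kap L ` seqs_below kap L)"

lemma topspace_bounded_topology:
  assumes "Well_order kap" "Field kap \<noteq> {}"
  shows "topspace (bounded_topology kap L) = seqs (Field kap) L"
proof
  show "topspace (bounded_topology kap L) \<subseteq> seqs (Field kap) L"
    by (auto simp: bounded_topology_def cone_def)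
  have lin: "wf (kap - Id)" "Total kap"
    using assms(1) by (auto simp: order_on_defs)
  obtain z where z: "z \<in> Field kap" "\<And>y. (y, z) \<in> kap - Id \<Longrightarrow> y \<notin> Field kap"
    using wfE_min[OF lin(1)] assms(2) by (metis equals0I)
  then have "underS kap z = {}"
    by (auto simp: underS_def Field_def)
  with z(1) have "Map.empty \<in> seqs_below kap L"
    by (auto simp: seqs_below_def seqs_def)
  moreover have "cone kap L Map.empty = seqs (Field kap) L"
    by (auto simp: cone_def)
  ultimately show "seqs (Field kap) L \<subseteq> topspace (bounded_topology kap L)"
    unfolding bounded_topology_def topology_generated_by_topspace by blast
qed


text \<open>
  The underlying monoid is written multiplicatively by the library: \<open>\<one>\<^bsub>S\<^esub>\<close> is the zero and
  \<open>\<otimes>\<^bsub>S\<^esub>\<close> the (not necessarily commutative) addition.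
\<close>

record 'a omonoid = "'a monoid" +
  order_rel :: "'a rel"

definition pos_tot_ordered_monoid :: "'a omonoid \<Rightarrow> bool" where
  "pos_tot_ordered_monoid S \<longleftrightarrow>
     monoid S \<and>
     linear_order_on (carrier S) (order_rel S) \<and>
     (\<forall>a b c d. (a, b) \<in> order_rel S \<longrightarrow> (c, d) \<in> order_rel S \<longrightarrow>
        (a \<otimes>\<^bsub>S\<^esub> c, b \<otimes>\<^bsub>S\<^esub> d) \<in> order_rel S) \<and>
     (\<forall>a\<in>carrier S. (\<one>\<^bsub>S\<^esub>, a) \<in> order_rel S) \<and>
     carrier S \<noteq> {\<one>\<^bsub>S\<^esub>}"

definition is_sup :: "'a omonoid \<Rightarrow> 'a set \<Rightarrow> 'a \<Rightarrow> bool" where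
  "is_sup S A b \<longleftrightarrow> b \<in> carrier S \<and> (\<forall>a\<in>A. (a, b) \<in> order_rel S) \<and>
     (\<forall>c\<in>carrier S. (\<forall>a\<in>A. (a, c) \<in> order_rel S) \<longrightarrow> (b, c) \<in> order_rel S)"

definition is_inf :: "'a omonoid \<Rightarrow> 'a set \<Rightarrow> 'a \<Rightarrow> bool" where
  "is_inf S A b \<longleftrightarrow> b \<in> carrier S \<and> (\<forall>a\<in>A. (b, a) \<in> order_rel S) \<and>
     (\<forall>c\<in>carrier S. (\<forall>a\<in>A. (c, a) \<in> order_rel S) \<longrightarrow> (c, b) \<in> order_rel S)"

definition limit_ordinal :: "'o rel \<Rightarrow> 'o \<Rightarrow> bool" where
  "limit_ordinal r \<alpha> \<longleftrightarrow> \<alpha> \<in> Field r \<and> underS r \<alpha> \<noteq> {} \<and>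
     (\<forall>\<beta>\<in>underS r \<alpha>. \<exists>\<gamma>\<in>underS r \<alpha>. \<beta> \<in> underS r \<gamma>)"

text \<open>
  The well-order \<open>On\<close> stands for the class of all ordinals, of which HOL can only represent
  initial segments; results about \<open>\<lambda>\<^sup>+\<close>-measures are stated for every \<open>On\<close> of length at least
  \<open>\<lambda>\<^sup>+\<close>, so that the sequences occurring in the additivity axiom are all available. In the clause for finite sequences, \<open>is\<close> lists the (finite) domain of \<open>s\<close> in
  increasing order.
\<close>

definition infinitary_sum ::
    "'o rel \<Rightarrow> 'a omonoid \<Rightarrow> (('o \<rightharpoonup> 'a) \<rightharpoonup> 'a) \<Rightarrow> bool" where
  "infinitary_sum On S InfSum \<longleftrightarrow>
     dom InfSum \<subseteq> seqs_below On (carrier S) \<and> ran InfSum \<subseteq> carrier S \<and>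
     InfSum Map.empty = Some \<one>\<^bsub>S\<^esub> \<and>
     (\<forall>s\<in>dom InfSum. \<forall>is. is \<noteq> [] \<and> set is = dom s \<and> sorted_wrt (\<lambda>i j. i \<in> underS On j) is \<longrightarrow>
        InfSum s = Some (foldr (\<otimes>\<^bsub>S\<^esub>) (map (\<lambda>i. the (s i)) is) \<one>\<^bsub>S\<^esub>)) \<and>
     (\<forall>\<alpha> s. limit_ordinal On \<alpha> \<and> s \<in> dom InfSum \<and> dom s = underS On \<alpha> \<and>
        (\<forall>\<beta>\<in>underS On \<alpha>. \<exists>\<gamma>\<in>underS On \<alpha>. (\<beta>, \<gamma>) \<in> On \<and> s |` underS On \<gamma> \<in> dom InfSum) \<longrightarrow>
        is_sup S {a. \<exists>\<gamma>\<in>underS On \<alpha>. InfSum (s |` underS On \<gamma>) = Some a} (the (InfSum s)))"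


definition weakly_measurable_space :: "'l rel \<Rightarrow> 'x topology \<Rightarrow> 'x set set \<Rightarrow> bool" where
  "weakly_measurable_space lam X M \<longleftrightarrow>
     M \<subseteq> Pow (topspace X) \<and>
     (\<forall>F\<subseteq>M. |F| \<le>o lam \<longrightarrow> \<Union>F \<in> M) \<and>
     (\<forall>U. openin X U \<longrightarrow> U \<in> M)"

definition open_local_basis :: "'x topology \<Rightarrow> 'x \<Rightarrow> 'x set set \<Rightarrow> bool" where
  "open_local_basis X x B \<longleftrightarrow>
     (\<forall>U\<in>B. openin X U \<and> x \<in> U) \<and>
     (\<forall>V. openin X V \<and> x \<in> V \<longrightarrow> (\<exists>U\<in>B. U \<subseteq> V))"

text \<open>
  An ordinal \<open>\<gamma>\<close> is below the successor cardinal of \<open>lam\<close> iff \<open>|\<gamma>| \<le> lam\<close>.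
\<close>

definition measure_on ::
    "'o rel \<Rightarrow> 'l rel \<Rightarrow> 'x topology \<Rightarrow> 'x set set \<Rightarrow> 'a omonoid \<Rightarrow> (('o \<rightharpoonup> 'a) \<rightharpoonup> 'a)
       \<Rightarrow> ('x set \<rightharpoonup> 'a) \<Rightarrow> bool" where
  "measure_on On lam X M S InfSum \<mu> \<longleftrightarrow>
     M \<subseteq> dom \<mu> \<and> dom \<mu> \<subseteq> Pow (topspace X) \<and> ran \<mu> \<subseteq> carrier S \<and>
     \<mu> {} = Some \<one>\<^bsub>S\<^esub> \<and>
     (\<one>\<^bsub>S\<^esub>, the (\<mu> (topspace X))) \<in> order_rel S \<and> \<mu> (topspace X) \<noteq> Some \<one>\<^bsub>S\<^esub> \<and>
     (\<forall>A\<in>M. \<forall>B\<in>M. A \<subseteq> B \<longrightarrow> (the (\<mu> A), the (\<mu> B)) \<in> order_rel S) \<and>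
     (\<forall>\<gamma>\<in>Field On. \<forall>A. |underS On \<gamma>| \<le>o lam \<and> A ` underS On \<gamma> \<subseteq> M \<and>
        disjoint_family_on A (underS On \<gamma>) \<longrightarrow>
        (\<mu> \<circ> A) |` underS On \<gamma> \<in> dom InfSum \<and>
        \<mu> (\<Union>i\<in>underS On \<gamma>. A i) = InfSum ((\<mu> \<circ> A) |` underS On \<gamma>)) \<and>
     (\<forall>x\<in>topspace X. {x} \<in> M \<longrightarrow>
        (\<forall>\<gamma>\<in>Field On. \<forall>A. |underS On \<gamma>| \<le>o lam \<and> open_local_basis X x (A ` underS On \<gamma>) \<longrightarrow>
           is_inf S ((\<lambda>i. the (\<mu> (A i))) ` underS On \<gamma>) (the (\<mu> {x}))))"

definition weak_measure_space ::
    "'o rel \<Rightarrow> 'l rel \<Rightarrow> 'x topology \<Rightarrow> 'x set set \<Rightarrow> 'a omonoid \<Rightarrow> (('o \<rightharpoonup> 'a) \<rightharpoonup> 'a)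
       \<Rightarrow> ('x set \<rightharpoonup> 'a) \<Rightarrow> bool" where
  "weak_measure_space On lam X M S InfSum \<mu> \<longleftrightarrow>
     weakly_measurable_space lam X M \<and> pos_tot_ordered_monoid S \<and> infinitary_sum On S InfSum \<and>
     measure_on On lam X M S InfSum \<mu>"

definition continuous_measure :: "'x topology \<Rightarrow> 'x set set \<Rightarrow> 'a omonoid \<Rightarrow> ('x set \<rightharpoonup> 'a) \<Rightarrow> bool"
where
  "continuous_measure X M S \<mu> \<longleftrightarrow> (\<forall>x\<in>topspace X. {x} \<in> M \<and> \<mu> {x} = Some \<one>\<^bsub>S\<^esub>)"

end

theory Submission
  imports Defs
begin

text \<open>
  Since \<open>\<lambda>\<^sup><\<^sup>\<kappa> > \<lambda>\<close> and \<open>\<kappa> \<le> \<lambda>\<close>, some \<open>\<alpha> < \<kappa>\<close> has more than \<open>\<lambda>\<close> sequences of length \<open>\<alpha>\<close>. Call a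
  set of branches null if it meets at most \<open>\<lambda>\<close> of the cones given by sequences of length \<open>\<alpha>\<close>. The
  null sets form a proper ideal closed under unions of size \<open>\<lambda>\<close>, and every point has a null
  neighbourhood, namely its own cone. The two-valued function that vanishes exactly on
  this ideal is therefore a continuous measure on the full power set, with values in the monoid
  \<open>{0 < 1}\<close> where \<open>1 + 1 = 1\<close> and infinite sums are suprema.
\<close>

section \<open>The two-element monoid and its infinite sums\<close>

text \<open>Zero and one are encoded as \<open>{}\<close> and \<open>UNIV\<close>, which differ
  because types are nonempty. Addition and supremum then both become union, and the order becomes
  inclusion.\<close>

definition two_monoid :: "'x set omonoid" where
  "two_monoid = \<lparr>carrier = {{}, UNIV}, mult = (\<union>), one = {},
     order_rel = {(a, b). a \<in> {{}, UNIV} \<and> b \<in> {{}, UNIV} \<and> a \<subseteq> b}\<rparr>"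

lemma two_monoid_simps [simp]:
  "carrier two_monoid = {{}, UNIV}"
  "a \<otimes>\<^bsub>two_monoid\<^esub> b = a \<union> b"
  "\<one>\<^bsub>two_monoid\<^esub> = {}"
  "order_rel two_monoid = {(a, b). a \<in> {{}, UNIV} \<and> b \<in> {{}, UNIV} \<and> a \<subseteq> b}"
  by (simp_all add: two_monoid_def)

lemma mult_two_monoid: "(\<otimes>\<^bsub>two_monoid\<^esub>) = (\<union>)"
  by (simp add: two_monoid_def)

lemma pos_tot_ordered_two_monoid: "pos_tot_ordered_monoid (two_monoid :: 'x set omonoid)"
proof -
  have "monoid (two_monoid :: 'x set omonoid)"
    by unfold_locales auto
  moreover have "linear_order_on (carrier (two_monoid :: 'x set omonoid)) (order_rel two_monoid)"
    by (auto simp: order_on_defs refl_on_def trans_def antisym_def total_on_def)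
  ultimately show ?thesis
    unfolding pos_tot_ordered_monoid_def by auto
qed

text \<open>The union of the range is the supremum of the values; the sum is defined on all
  sequences whose length is an element of \<open>On\<close>.\<close>

definition two_sum :: "'o rel \<Rightarrow> ('o \<rightharpoonup> 'x set) \<rightharpoonup> 'x set" where
  "two_sum On s = (if s \<in> seqs_below On {{}, UNIV} then Some (\<Union>(ran s)) else None)"

lemma Union_ran_two: "ran s \<subseteq> {{}, UNIV} \<Longrightarrow> \<Union>(ran s) \<in> {{}, UNIV}"
  by auto

lemma dom_two_sum: "dom (two_sum On) = seqs_below On {{}, UNIV}"
  by (auto simp: two_sum_def split: if_splits)

lemma empty_in_seqs_below:
  assumes "Well_order r" and "Field r \<noteq> {}"
  shows "Map.empty \<in> seqs_below r A"
proof -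
  have "wf (r - Id)"
    using assms(1) by (simp add: well_order_on_def)
  then obtain z where z: "z \<in> Field r" "\<And>y. (y, z) \<in> r - Id \<Longrightarrow> y \<notin> Field r"
    using wfE_min[of "r - Id"] assms(2) by (metis equals0I)
  then have "underS r z = {}"
    by (auto simp: underS_def Field_def)
  with z(1) show ?thesis
    by (auto simp: seqs_below_def seqs_def)
qed

text \<open>Ensures that all partial sums in the continuity axiom are defined.\<close>

lemma restrict_in_seqs_below:
  assumes "Well_order r" and "\<alpha> \<in> Field r" and "\<gamma> \<in> underS r \<alpha>" and "s \<in> seqs (underS r \<alpha>) A"
  shows "s |` underS r \<gamma> \<in> seqs_below r A"
proof -
  have "underS r \<gamma> \<subseteq> underS r \<alpha>"
    using assms(1,3) by (intro underS_incr) (auto simp: order_on_defs underS_def)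
  moreover have "\<gamma> \<in> Field r"
    using assms(3) by (auto simp: underS_def Field_def)
  moreover have "ran (s |` underS r \<gamma>) \<subseteq> ran s"
    by (auto simp: ran_def restrict_map_def split: if_splits)
  ultimately show ?thesis
    using assms(4) unfolding seqs_below_def seqs_def by (intro UN_I[of \<gamma>]) auto
qed

text \<open>Below a limit every index lies in a proper initial segment, so every value of
  \<open>s\<close> already occurs in some restriction, and the union of the partial unions is the
  full union.\<close>

lemma two_sum_limit:
  fixes s :: "'o \<rightharpoonup> 'x set"
  assumes On: "Well_order On" and lim: "limit_ordinal On \<alpha>"
    and s: "s \<in> seqs_below On {{}, UNIV}" and dom: "dom s = underS On \<alpha>"
  shows "is_sup two_monoid {a. \<exists>\<gamma>\<in>underS On \<alpha>. two_sum On (s |` underS On \<gamma>) = Some a}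
           (the (two_sum On s))"
proof -
  have ran: "ran s \<subseteq> {{}, UNIV}"
    using s by (auto simp: seqs_below_def seqs_def)
  have \<alpha>: "\<alpha> \<in> Field On" and s\<alpha>: "s \<in> seqs (underS On \<alpha>) {{}, UNIV}"
    using lim dom ran by (auto simp: limit_ordinal_def seqs_def)
  have val: "two_sum On (s |` underS On \<gamma>) = Some (\<Union>(ran (s |` underS On \<gamma>)))"
    if "\<gamma> \<in> underS On \<alpha>" for \<gamma>
    using restrict_in_seqs_below[OF On \<alpha> that s\<alpha>] by (simp add: two_sum_def)
  have mono: "ran (s |` I) \<subseteq> ran s" for I
    by (auto simp: ran_def restrict_map_def split: if_splits)
  have upper: "\<Union>(ran (s |` I)) \<in> {{}, UNIV} \<and> \<Union>(ran (s |` I)) \<subseteq> \<Union>(ran s)" for I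
    using Union_ran_two[of "s |` I"] mono[of I] ran by (meson Union_mono subset_trans)
  have least: "\<Union>(ran s) \<subseteq> c"
    if c: "\<And>\<gamma>. \<gamma> \<in> underS On \<alpha> \<Longrightarrow> \<Union>(ran (s |` underS On \<gamma>)) \<subseteq> c" for c
  proof
    fix p assume "p \<in> \<Union>(ran s)"
    then obtain i a where i: "s i = Some a" "p \<in> a"
      by (auto simp: ran_def)
    then have "i \<in> underS On \<alpha>"
      using dom by auto
    \<comment> \<open>The limit property gives \<gamma> strictly between \<open>i\<close> and
      \<alpha>, so that \<open>i\<close> belongs to the restricted domain.\<close>
    then obtain \<gamma> where "\<gamma> \<in> underS On \<alpha>" "i \<in> underS On \<gamma>"
      using lim by (auto simp: limit_ordinal_def)
    moreover from this have "a \<in> ran (s |` underS On \<gamma>)"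
      using i by (auto simp: ran_def restrict_map_def)
    ultimately show "p \<in> c"
      using c i by blast
  qed
  have "the (two_sum On s) = \<Union>(ran s)"
    using s by (simp add: two_sum_def)
  moreover have "{a. \<exists>\<gamma>\<in>underS On \<alpha>. two_sum On (s |` underS On \<gamma>) = Some a} =
      (\<lambda>\<gamma>. \<Union>(ran (s |` underS On \<gamma>))) ` underS On \<alpha>"
    using val by auto
  ultimately show ?thesis
    unfolding is_sup_def using upper least Union_ran_two[OF ran] by simp
qed

lemma infinitary_sum_two_sum:
  fixes On :: "'o rel"
  assumes On: "Well_order On" and "Field On \<noteq> {}"
  shows "infinitary_sum On (two_monoid :: 'x set omonoid) (two_sum On)"
proof -
  have ran: "ran (two_sum On) \<subseteq> {{}, UNIV :: 'x set}"
  proof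
    fix a :: "'x set" assume "a \<in> ran (two_sum On)"
    then obtain s where "s \<in> seqs_below On {{}, UNIV}" "a = \<Union>(ran s)"
      by (auto simp: ran_def two_sum_def split: if_splits)
    then show "a \<in> {{}, UNIV}"
      using Union_ran_two[of s] by (auto simp: seqs_below_def seqs_def)
  qed
  have finite_sum: "two_sum On s = Some (foldr (\<union>) (map (\<lambda>i. the (s i)) is) {})"
    if "s \<in> seqs_below On {{}, UNIV}" and "set is = dom s" for s :: "'o \<rightharpoonup> 'x set" and "is"
  proof -
    \<comment> \<open>Union is commutative and idempotent, so the fold depends only on the set of
      listed indices.\<close>
    have "foldr (\<union>) (map (\<lambda>i. the (s i)) is) {} = (\<Union>i\<in>set is. the (s i))"
      by (induction "is") auto
    also have "\<dots> = \<Union>(ran s)"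
      unfolding that(2) by (force simp: ran_def dom_def)
    finally show ?thesis
      using that(1) by (simp add: two_sum_def)
  qed
  have zero: "two_sum On Map.empty = Some {}"
    using empty_in_seqs_below[OF assms] by (simp add: two_sum_def)
  show ?thesis
    unfolding infinitary_sum_def dom_two_sum two_monoid_simps mult_two_monoid
    by (intro conjI ballI allI impI; (elim conjE)?)
      (rule subset_refl ran zero finite_sum two_sum_limit[OF On]; assumption)+
qed

section \<open>The two-valued measure attached to an ideal of null sets\<close>

text \<open>The guard keeps the domain inside the power set of the space, as \<open>N\<close> may
  also contain sets with elements outside it.\<close>

definition null_measure :: "'x topology \<Rightarrow> 'x set set \<Rightarrow> 'x set \<rightharpoonup> 'x set" where
  "null_measure X N A = (if A \<subseteq> topspace X then Some (if A \<in> N then {} else UNIV) else None)"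

text \<open>Additivity reflects that \<open>N\<close> is an ideal closed under unions of size at
  most \<open>lam\<close>. The null neighbourhoods make every point null and force the infimum over
  each local basis to be zero.\<close>

lemma
  fixes On :: "'o rel" and X :: "'x topology"
  assumes Field: "Field On \<noteq> {}" and On: "Well_order On" and lam: "Well_order lam"
    and null_UN: "\<And>F. F \<subseteq> N \<Longrightarrow> |F| \<le>o lam \<Longrightarrow> \<Union>F \<in> N"
    and null_subset: "\<And>A B. B \<in> N \<Longrightarrow> A \<subseteq> B \<Longrightarrow> A \<in> N"
    and proper: "topspace X \<notin> N"
    and locally_null: "\<And>x. x \<in> topspace X \<Longrightarrow> \<exists>U\<in>N. openin X U \<and> x \<in> U"
  shows weak_measure_space_null_measure:
      "weak_measure_space On lam X (Pow (topspace X)) two_monoid (two_sum On) (null_measure X N)"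
    and continuous_null_measure:
      "continuous_measure X (Pow (topspace X)) two_monoid (null_measure X N)"
proof -
  let ?\<mu> = "null_measure X N"
  have empty: "{} \<in> N"
    using null_UN[of "{}"] card_of_empty1 lam by auto
  have single: "{x} \<in> N" if "x \<in> topspace X" for x
    using locally_null[OF that] null_subset by (metis empty_subsetI insert_subset)
  have additive: "(?\<mu> \<circ> A) |` underS On \<gamma> \<in> dom (two_sum On) \<and>
      ?\<mu> (\<Union>i\<in>underS On \<gamma>. A i) = two_sum On ((?\<mu> \<circ> A) |` underS On \<gamma>)"
    if \<gamma>: "\<gamma> \<in> Field On" and small: "|underS On \<gamma>| \<le>o lam"
      and A: "A ` underS On \<gamma> \<subseteq> Pow (topspace X)" for \<gamma> A
  proof -
    let ?I = "underS On \<gamma>"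
    have val: "?\<mu> (A i) = Some (if A i \<in> N then {} else UNIV)" if "i \<in> ?I" for i
      using A that by (auto simp: null_measure_def)
    have ran: "ran ((?\<mu> \<circ> A) |` ?I) = (\<lambda>i. if A i \<in> N then {} else UNIV) ` ?I"
      using val by (force simp: ran_def restrict_map_def)
    have "dom ((?\<mu> \<circ> A) |` ?I) = ?I"
      using val by (auto simp: restrict_map_def dom_def)
    then have dom: "(?\<mu> \<circ> A) |` ?I \<in> seqs_below On {{}, UNIV}"
      using \<gamma> ran by (auto simp: seqs_below_def seqs_def)
    \<comment> \<open>This is additivity: the union has measure zero exactly when every term of the
      sum is zero. Closure under unions gives one direction, closure under subsets the
      other.\<close>
    have "(\<Union>i\<in>?I. A i) \<in> N \<longleftrightarrow> (\<forall>i\<in>?I. A i \<in> N)"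
    proof
      assume "\<forall>i\<in>?I. A i \<in> N"
      moreover have "|A ` ?I| \<le>o lam"
        using small card_of_image ordLeq_transitive by blast
      ultimately show "(\<Union>i\<in>?I. A i) \<in> N"
        using null_UN[of "A ` ?I"] by blast
    next
      assume "(\<Union>i\<in>?I. A i) \<in> N"
      then show "\<forall>i\<in>?I. A i \<in> N"
        using null_subset by blast
    qed
    moreover have "(\<Union>i\<in>?I. A i) \<subseteq> topspace X"
      using A by blast
    ultimately have "?\<mu> (\<Union>i\<in>?I. A i) = Some (\<Union>(ran ((?\<mu> \<circ> A) |` ?I)))"
      unfolding ran by (auto simp: null_measure_def)
    then show ?thesis
      using dom by (simp add: dom_two_sum two_sum_def)
  qed
  have inf: "is_inf two_monoid ((\<lambda>i. the (?\<mu> (A i))) ` I) (the (?\<mu> {x}))"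
    if x: "x \<in> topspace X" and basis: "open_local_basis X x (A ` I)" for x A and I :: "'o set"
  proof -
    obtain U where "U \<in> N" "openin X U" "x \<in> U"
      using locally_null[OF x] by blast
    \<comment> \<open>Some basis set refines the null neighbourhood and is itself null, so the
      infimum zero is attained.\<close>
    then obtain i where i: "i \<in> I" "A i \<subseteq> U"
      using basis unfolding open_local_basis_def by blast
    then have "A i \<in> N"
      using \<open>U \<in> N\<close> null_subset by blast
    have sub: "A j \<subseteq> topspace X" if "j \<in> I" for j
      using basis that openin_subset[of X "A j"] by (simp add: open_local_basis_def)
    then have "the (?\<mu> (A j)) \<in> {{}, UNIV}" if "j \<in> I" for j
      using that by (simp add: null_measure_def)
    moreover have "the (?\<mu> (A i)) = {}"
      using \<open>A i \<in> N\<close> sub[OF i(1)] by (simp add: null_measure_def)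
    moreover have "the (?\<mu> {x}) = {}"
      using x single[OF x] by (simp add: null_measure_def)
    ultimately show ?thesis
      using i(1) by (auto simp: is_inf_def intro!: bexI[of _ i])
  qed
  have "weakly_measurable_space lam X (Pow (topspace X))"
    unfolding weakly_measurable_space_def using openin_subset by blast
  moreover have "measure_on On lam X (Pow (topspace X)) two_monoid (two_sum On) ?\<mu>"
  proof -
    have dom: "dom ?\<mu> = Pow (topspace X)" and ran: "ran ?\<mu> \<subseteq> {{}, UNIV}"
      by (auto simp: null_measure_def ran_def split: if_splits)
    have bounds: "?\<mu> {} = Some {}" "?\<mu> (topspace X) = Some UNIV"
      using empty proper by (auto simp: null_measure_def)
    have mono: "(the (?\<mu> A), the (?\<mu> B)) \<in> order_rel two_monoid"
      if "A \<in> Pow (topspace X)" "B \<in> Pow (topspace X)" "A \<subseteq> B" for A B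
      using that null_subset by (auto simp: null_measure_def)
    show ?thesis
      unfolding measure_on_def
    proof (intro conjI ballI allI impI)
      show "?\<mu> {} = Some \<one>\<^bsub>two_monoid\<^esub>" "?\<mu> (topspace X) \<noteq> Some \<one>\<^bsub>two_monoid\<^esub>"
        "(\<one>\<^bsub>two_monoid\<^esub>, the (?\<mu> (topspace X))) \<in> order_rel two_monoid"
        using bounds by simp_all
    qed (use dom ran mono additive inf in \<open>(simp; fail | blast)+\<close>)
  qed
  ultimately show "weak_measure_space On lam X (Pow (topspace X)) two_monoid (two_sum On) ?\<mu>"
    unfolding weak_measure_space_def
    using pos_tot_ordered_two_monoid infinitary_sum_two_sum[OF On Field] by blast
  show "continuous_measure X (Pow (topspace X)) two_monoid ?\<mu>"
    unfolding continuous_measure_def using single by (auto simp: null_measure_def)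
qed

section \<open>The ideal of sets meeting few cones\<close>

text \<open>Otherwise the sequences of length below \<open>kap\<close> would form a union of at most
  \<open>lam\<close> levels of size at most \<open>lam\<close>, which has size at most
  \<open>lam\<close> because \<open>lam\<close> is infinite.\<close>

lemma exists_large_level:
  assumes "Card_order lam" and "cinfinite lam" and "kap \<le>o lam" and "Card_order kap"
    and "lam <o |seqs_below kap L|"
  shows "\<exists>\<alpha>\<in>Field kap. \<not> |seqs (underS kap \<alpha>) L| \<le>o lam"
proof (rule ccontr)
  assume "\<not> ?thesis"
  moreover have "|Field kap| \<le>o lam"
    using assms(3,4) card_of_Field_ordIso ordIso_ordLeq_trans by blast
  ultimately have "|seqs_below kap L| \<le>o lam"
    unfolding seqs_below_def using assms(1,2)
    by (intro card_of_UNION_ordLeq_infinite_Field) (auto simp: cinfinite_def)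
  then show False
    using assms(5) not_ordLess_ordLeq by blast
qed

text \<open>A sequence on \<open>I\<close> extends to \<open>J\<close> by a constant value from
  \<open>L\<close>. Hence the whole space meets every cone of the chosen level.\<close>

lemma restrict_seqs_onto:
  assumes "I \<subseteq> J" and "L \<noteq> {}"
  shows "(\<lambda>x. x |` I) ` seqs J L = seqs I L"
proof
  show "(\<lambda>x. x |` I) ` seqs J L \<subseteq> seqs I L"
    using assms(1) by (force simp: seqs_def ran_def restrict_map_def split: if_splits)
  show "seqs I L \<subseteq> (\<lambda>x. x |` I) ` seqs J L"
  proof
    fix s assume s: "s \<in> seqs I L"
    obtain l where l: "l \<in> L"
      using assms(2) by blast
    let ?x = "\<lambda>i. if i \<in> I then s i else if i \<in> J then Some l else None"
    have "?x \<in> seqs J L"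
      using s l assms(1) by (auto simp: seqs_def ran_def dom_def split: if_splits)
    moreover have "s = ?x |` I"
      using s by (auto simp: seqs_def restrict_map_def fun_eq_iff)
    ultimately show "s \<in> (\<lambda>x. x |` I) ` seqs J L"
      by blast
  qed
qed

theorem corollary8p5:
  fixes kap :: "'k rel" and lam :: "'l rel" and On :: "'o rel"
  assumes "Card_order kap" and "cinfinite kap" and "regularCard kap"
    and "Card_order lam" and "cinfinite lam"
    and "kap \<le>o lam"
    and "lam <o |seqs_below kap (Field lam)|"
    and "Well_order On" and "cardSuc lam \<le>o On"
  shows "\<exists>(M :: ('k \<rightharpoonup> 'l) set set) (S :: ('k \<rightharpoonup> 'l) set omonoid) InfSum \<mu>.
           weak_measure_space On lam (bounded_topology kap (Field lam)) M S InfSum \<mu> \<and>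
           continuous_measure (bounded_topology kap (Field lam)) M S \<mu>"
proof -
  let ?L = "Field lam" and ?X = "bounded_topology kap (Field lam)"
  obtain \<alpha> where \<alpha>: "\<alpha> \<in> Field kap" and large: "\<not> |seqs (underS kap \<alpha>) ?L| \<le>o lam"
    using exists_large_level[OF assms(4,5,6,1,7)] by blast
  \<comment> \<open>Restriction to length \<alpha> sends a branch to the sequence indexing its cone,
    so the image lists the cones met by \<open>A\<close>.\<close>
  define N :: "('k \<rightharpoonup> 'l) set set" where "N = {A. |(\<lambda>x. x |` underS kap \<alpha>) ` A| \<le>o lam}"
  have L: "?L \<noteq> {}"
    using assms(5) by (auto simp: cinfinite_def)
  have sub: "underS kap \<alpha> \<subseteq> Field kap"
    by (auto simp: underS_def Field_def)
  have top: "topspace ?X = seqs (Field kap) ?L"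
    using assms(1) \<alpha> by (intro topspace_bounded_topology) (auto simp: card_order_on_def)
  have "Field On \<noteq> {}"
  proof -
    have "|Field (cardSuc lam)| \<le>o |Field On|"
      using assms(9) by (rule card_of_mono2)
    moreover have "Field (cardSuc lam) \<noteq> {}"
      using assms(4) L by (simp add: Field_cardSuc_not_empty)
    ultimately show ?thesis
      by (metis card_of_empty3)
  qed
  moreover have "Well_order On" "Well_order lam"
    using assms(4,8) by (auto simp: card_order_on_def)
  moreover have "\<Union>F \<in> N" if F: "F \<subseteq> N" "|F| \<le>o lam" for F
    \<comment> \<open>Images commute with unions, and a union of at most \<open>lam\<close> sets of
      size at most \<open>lam\<close> stays within \<open>lam\<close>.\<close>
    unfolding N_def mem_Collect_eq image_Union using F assms(4,5)
    by (intro card_of_UNION_ordLeq_infinite_Field) (auto simp: cinfinite_def N_def)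
  moreover have "A \<in> N" if "B \<in> N" "A \<subseteq> B" for A B
    using that card_of_mono1[OF image_mono[OF that(2)]] ordLeq_transitive unfolding N_def by blast
  \<comment> \<open>The image of the whole space is the full level \<alpha>, which was chosen too
    large.\<close>
  moreover have "topspace ?X \<notin> N"
    using large restrict_seqs_onto[OF sub L] by (simp add: N_def top)
  moreover have "\<exists>U\<in>N. openin ?X U \<and> x \<in> U" if x: "x \<in> topspace ?X" for x
  proof
    \<comment> \<open>The witness is the cone of \<open>?s\<close>: it is a basic open set, and all
      its branches have the same restriction to \<alpha>, so its image is a singleton.\<close>
    let ?s = "x |` underS kap \<alpha>"
    have s: "?s \<in> seqs (underS kap \<alpha>) ?L"
      using x restrict_seqs_onto[OF sub L] unfolding top by blast
    then have "openin ?X (cone kap ?L ?s)"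
      using \<alpha> unfolding bounded_topology_def
      by (intro topology_generated_by_Basis) (auto simp: seqs_below_def)
    moreover have "x \<in> cone kap ?L ?s"
      using x top by (auto simp: cone_def map_le_def)
    ultimately show "openin ?X (cone kap ?L ?s) \<and> x \<in> cone kap ?L ?s" ..
    have "y |` underS kap \<alpha> = ?s" if "y \<in> cone kap ?L ?s" for y
      using that s by (auto simp: cone_def map_le_def seqs_def restrict_map_def fun_eq_iff)
    then have "(\<lambda>y. y |` underS kap \<alpha>) ` cone kap ?L ?s \<subseteq> {?s}"
      by blast
    moreover have "|{?s}| \<le>o lam"
      by (rule ordLeq_ordIso_trans[OF card_of_singl_ordLeq[OF L] card_of_Field_ordIso[OF assms(4)]])
    ultimately show "cone kap ?L ?s \<in> N"
      unfolding N_def mem_Collect_eq by (rule ordLeq_transitive[OF card_of_mono1])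
  qed
  ultimately have "weak_measure_space On lam ?X (Pow (topspace ?X)) two_monoid (two_sum On)
        (null_measure ?X N) \<and>
      continuous_measure ?X (Pow (topspace ?X)) two_monoid (null_measure ?X N)"
    by (intro conjI weak_measure_space_null_measure continuous_null_measure)
  then show ?thesis
    by blast
qed

end
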